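(* For every $f\in L^2(\Lambda_A,\mu_A)$ with $\|f\|=1$, the measure $\mu_f(E)=\langle f,P(E)f\rangle$ satisfies $$\sum_{k=0}^{N-1}\int_{\Lambda_A}\psi\circ\sigma_k\,d\mu_{S_k^*f}=\int_{\Lambda_A}\psi\,d\mu_f$$ for every continuous function $\psi$ on $\Lambda_A$. The Fourier transform $\widehat{\mu_f}(t)=\int e^{itx}\,d\mu_f(x)$ satisfies $$\widehat{\mu_f}(t)=\sum_{k=0}^{N-1}e^{\frac{itk}{N}}\;\widehat{\mu_{S_k^*f}}\!\left(\frac{t}{N}\right).$$
   Context: Let $A=(A_{ij})_{i,j=0,\dots,N-1}$ ($N\ge2$) be a matrix with entries in $\{0,1\}$ and $A_{ii}=1$ for all $i$. $\Lambda_A$ is the set of infinite sequences $x=(x_1x_2x_3\dots)$ with $x_i\in\{0,\dots,N-1\}$ and $A_{x_ix_{i+1}}=1$ for all $i\ge1$ (with the product topology). It is identified with a subset of $[0,1]$ through the value $\mathrm{val}(x)=\sum_{i\ge1}x_iN^{-i}$, points with two admissible expansions being counted as two points; in $e^{itx}$ the symbol $x$ denotes this value. $\delta_A$ is the Hausdorff dimension of $\mathrm{val}(\Lambda_A)\subset[0,1]$, and $\mu_A$ is the $\delta_A$-dimensional Hausdorff measure $\mathcal{H}^{\delta_A}$ on $\Lambda_A$, i.e. $\mu_A(B)=\int_{[0,1]}\#\{w\in B:\mathrm{val}(w)=y\}\,d\mathcal{H}^{\delta_A}(y)$. $\sigma(x_1x_2\dots)=(x_2x_3\dots)$; $D_i=\{x\in\Lambda_A:A_{ix_1}=1\}$,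 $R_i=\{x\in\Lambda_A:x_1=i\}$, $\sigma_i:D_i\to R_i$, $\sigma_i(x)=ix$, i.e. $\mathrm{val}(\sigma_i(x))=(\mathrm{val}(x)+i)/N$; $\Phi_{\sigma_i}=d(\mu_A\circ\sigma_i)/d\mu_A$ on $D_i$. $(S_if)(x)=\chi_{R_i}(x)\,\Phi_{\sigma_i}(\sigma(x))^{-1/2}f(\sigma(x))$ on $L^2(\Lambda_A,\mu_A)$, with adjoint $S_i^*$. $P(E)$ is the projection given by multiplication by the characteristic function of the Borel set $E\subset\Lambda_A$, and for any $g\in L^2(\Lambda_A,\mu_A)$ (not necessarily of norm one) $\mu_g(E)=\langle g,P(E)g\rangle$. The function $\psi\circ\sigma_k$ is defined on $D_k$ and is set to be $0$ outside $D_k$. *)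

theory Defs
  imports "HOL-Analysis.Analysis"
begin

section \<open>Hausdorff measure and Hausdorff dimension\<close>

text \<open>
  The contribution \<open>diam(U)\<^sup>s\<close> of one covering set.  The case \<open>s = 0\<close> is separate because
  \<open>0 powr 0 = 0\<close>, whereas the zero-dimensional Hausdorff measure is counting measure.
\<close>

definition hausdorff_gauge :: "real \<Rightarrow> 'a::metric_space set \<Rightarrow> ennreal" where
  "hausdorff_gauge s U =
     (if U = {} then 0 else if s = 0 then 1 else ennreal (diameter U powr s))"

definition hausdorff_outer :: "real \<Rightarrow> 'a::metric_space set \<Rightarrow> ennreal" where
  "hausdorff_outer s E =
     (SUP d\<in>{0::real<..}.
        INF U\<in>{U :: nat \<Rightarrow> 'a set. (\<forall>i. bounded (U i) \<and> diameter (U i) \<le> d) \<and> E \<subseteq> (\<Union>i. U i)}.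
          (\<Sum>i. hausdorff_gauge s (U i)))"

definition hausdorff_measure :: "real \<Rightarrow> 'a::metric_space measure" where
  "hausdorff_measure s = measure_of UNIV (sets borel) (hausdorff_outer s)"

text \<open>
  Restricted to Euclidean spaces, where the infimum is over a nonempty set, so that it is the
  true (finite) dimension.
\<close>

definition hausdorff_dim :: "'a::euclidean_space set \<Rightarrow> real" where
  "hausdorff_dim E = Inf {s. 0 \<le> s \<and> hausdorff_outer s E = 0}"


section \<open>Square-integrable functions\<close>

text \<open>
  Elements of \<open>L\<^sup>2(M)\<close> are represented by functions; the notions below depend only
  on the class modulo equality almost everywhere.
\<close>

definition L2 :: "'a measure \<Rightarrow> ('a \<Rightarrow> complex) set" where
  "L2 M = {f \<in> borel_measurable M. integrable M (\<lambda>x. (cmod (f x))\<^sup>2)}"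

definition L2_inner :: "'a measure \<Rightarrow> ('a \<Rightarrow> complex) \<Rightarrow> ('a \<Rightarrow> complex) \<Rightarrow> complex" where
  "L2_inner M f g = (\<integral>x. f x * cnj (g x) \<partial>M)"

definition L2_norm :: "'a measure \<Rightarrow> ('a \<Rightarrow> complex) \<Rightarrow> real" where
  "L2_norm M f = sqrt (\<integral>x. (cmod (f x))\<^sup>2 \<partial>M)"

text \<open>A representative of \<open>T\<^sup>* g\<close>; the defining condition determines it almost everywhere.\<close>

definition L2_adjoint ::
  "'a measure \<Rightarrow> (('a \<Rightarrow> complex) \<Rightarrow> 'a \<Rightarrow> complex) \<Rightarrow> ('a \<Rightarrow> complex) \<Rightarrow> 'a \<Rightarrow> complex" where
  "L2_adjoint M T g = (SOME h. h \<in> L2 M \<and> (\<forall>f\<in>L2 M. L2_inner M (T f) g = L2_inner M f h))"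

definition mult_proj :: "'a set \<Rightarrow> ('a \<Rightarrow> complex) \<Rightarrow> 'a \<Rightarrow> complex" where
  "mult_proj E g = (\<lambda>x. indicator E x * g x)"

text \<open>The measure \<open>E \<mapsto> \<langle>g, P(E) g\<rangle>\<close>; this inner product is a nonnegative real number.\<close>

definition proj_measure :: "'a measure \<Rightarrow> ('a \<Rightarrow> complex) \<Rightarrow> 'a measure" where
  "proj_measure M g =
     measure_of (space M) (sets M) (\<lambda>E. ennreal (Re (L2_inner M g (mult_proj E g))))"


section \<open>The limit set of a 0-1 matrix\<close>

text \<open>
  The sequence \<open>x\<^sub>1 x\<^sub>2 x\<^sub>3 \<dots>\<close> is the function with \<open>x 0 = x\<^sub>1\<close>, \<open>x 1 = x\<^sub>2\<close>, and so on.  The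
  type \<^typ>\<open>nat \<Rightarrow> nat\<close> carries the product topology of the discrete topologies.  The matrix is
  indexed by \<open>0, \<dots>, N - 1\<close>; its values outside this range are irrelevant.
\<close>

definition Lam :: "nat \<Rightarrow> (nat \<Rightarrow> nat \<Rightarrow> nat) \<Rightarrow> (nat \<Rightarrow> nat) set" where
  "Lam N A = {x. (\<forall>i. x i < N) \<and> (\<forall>i. A (x i) (x (Suc i)) = 1)}"

definition val :: "nat \<Rightarrow> (nat \<Rightarrow> nat) \<Rightarrow> real" where
  "val N x = (\<Sum>i. real (x i) / real N ^ Suc i)"

definition dimA :: "nat \<Rightarrow> (nat \<Rightarrow> nat \<Rightarrow> nat) \<Rightarrow> real" where
  "dimA N A = hausdorff_dim (val N ` Lam N A)"

definition muA :: "nat \<Rightarrow> (nat \<Rightarrow> nat \<Rightarrow> nat) \<Rightarrow> (nat \<Rightarrow> nat) measure" where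
  "muA N A = measure_of (Lam N A) (sets (restrict_space borel (Lam N A)))
     (\<lambda>B. \<integral>\<^sup>+y\<in>{0..1}. emeasure (count_space UNIV) {w \<in> B. val N w = y}
            \<partial>hausdorff_measure (dimA N A))"

definition shift :: "(nat \<Rightarrow> nat) \<Rightarrow> nat \<Rightarrow> nat" where
  "shift x = (\<lambda>n. x (Suc n))"

definition prepend :: "nat \<Rightarrow> (nat \<Rightarrow> nat) \<Rightarrow> nat \<Rightarrow> nat" where
  "prepend i x = case_nat i x"

definition Dom :: "nat \<Rightarrow> (nat \<Rightarrow> nat \<Rightarrow> nat) \<Rightarrow> nat \<Rightarrow> (nat \<Rightarrow> nat) set" where
  "Dom N A i = {x \<in> Lam N A. A i (x 0) = 1}"

definition Ran :: "nat \<Rightarrow> (nat \<Rightarrow> nat \<Rightarrow> nat) \<Rightarrow> nat \<Rightarrow> (nat \<Rightarrow> nat) set" where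
  "Ran N A i = {x \<in> Lam N A. x 0 = i}"

text \<open>The measure \<open>\<mu>\<^sub>A \<circ> \<sigma>\<^sub>i\<close>, that is \<open>B \<mapsto> \<mu>\<^sub>A(\<sigma>\<^sub>i(B))\<close>, on \<open>D\<^sub>i\<close>.\<close>

definition muA_prepend :: "nat \<Rightarrow> (nat \<Rightarrow> nat \<Rightarrow> nat) \<Rightarrow> nat \<Rightarrow> (nat \<Rightarrow> nat) measure" where
  "muA_prepend N A i = measure_of (Dom N A i) (sets (restrict_space (muA N A) (Dom N A i)))
     (\<lambda>B. emeasure (muA N A) (prepend i ` B))"

definition Phi :: "nat \<Rightarrow> (nat \<Rightarrow> nat \<Rightarrow> nat) \<Rightarrow> nat \<Rightarrow> (nat \<Rightarrow> nat) \<Rightarrow> ennreal" where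
  "Phi N A i = RN_deriv (restrict_space (muA N A) (Dom N A i)) (muA_prepend N A i)"

definition S_op ::
  "nat \<Rightarrow> (nat \<Rightarrow> nat \<Rightarrow> nat) \<Rightarrow> nat \<Rightarrow> ((nat \<Rightarrow> nat) \<Rightarrow> complex) \<Rightarrow> (nat \<Rightarrow> nat) \<Rightarrow> complex" where
  "S_op N A i f = (\<lambda>x. indicator (Ran N A i) x *
     complex_of_real (enn2real (Phi N A i (shift x)) powr (- 1 / 2)) * f (shift x))"

definition S_adj ::
  "nat \<Rightarrow> (nat \<Rightarrow> nat \<Rightarrow> nat) \<Rightarrow> nat \<Rightarrow> ((nat \<Rightarrow> nat) \<Rightarrow> complex) \<Rightarrow> (nat \<Rightarrow> nat) \<Rightarrow> complex" where
  "S_adj N A i = L2_adjoint (muA N A) (S_op N A i)"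

definition fourier :: "nat \<Rightarrow> (nat \<Rightarrow> nat) measure \<Rightarrow> real \<Rightarrow> complex" where
  "fourier N M t = (\<integral>x. exp (\<i> * complex_of_real (t * val N x)) \<partial>M)"

end

theory Submission
  imports Defs
begin

text \<open>
  The map \<open>\<sigma>\<^sub>k\<close> acts on values as the similarity \<open>y \<mapsto> (y + k) / N\<close>, and the
  \<open>\<delta>\<close>-dimensional Hausdorff measure scales under a similarity of ratio \<open>r\<close> by the factor
  \<open>r\<close> to the power \<open>\<delta>\<close>.  Hence \<open>\<mu>\<^sub>A(\<sigma>\<^sub>k(B)) = c \<mu>\<^sub>A(B)\<close> for \<open>B \<subseteq> D\<^sub>k\<close>,
  where \<open>c\<close> is \<open>1 / N\<close> to the power \<open>\<delta>\<^sub>A\<close> (lemma \<open>emeasure_muA_prepend\<close>), so that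
  the Radon-Nikodym derivative \<open>\<Phi>\<close> equals \<open>c\<close> almost everywhere on the
  support of any square-integrable function (lemma \<open>Phi_AE\<close>) and
  \<open>S\<^sub>k\<^sup>* f\<close> is \<open>f \<circ> \<sigma>\<^sub>k\<close> on \<open>D\<^sub>k\<close>, multiplied by the square root of \<open>c\<close>
  (lemmas \<open>S_op_adjoint\<close> and \<open>S_adj_AE\<close>).  Since \<open>\<mu>\<^sub>g\<close> has density \<open>|g|\<^sup>2\<close>
  with respect to \<open>\<mu>\<^sub>A\<close>, the change of variables \<open>\<sigma>\<^sub>k : D\<^sub>k \<rightarrow> R\<^sub>k\<close> turns the integral
  of \<open>\<psi> \<circ> \<sigma>\<^sub>k\<close> against the measure of \<open>S\<^sub>k\<^sup>* f\<close> into the integral of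
  \<open>\<psi> |f|\<^sup>2\<close> over \<open>R\<^sub>k\<close>.  The sets \<open>R\<^sub>k\<close> partition the sequence space, and
  summation over \<open>k\<close> gives the first identity; continuous \<open>\<psi>\<close> are bounded because
  the space is compact.  The second identity is the case \<open>\<psi>(x) = exp (i t val x)\<close>.

  No finiteness property of \<open>\<mu>\<^sub>A\<close> is used, and neither is the countable additivity of the
  Hausdorff outer measure.  If a set function fails to be a measure, the measure constructed from it
  is zero; since \<open>f\<close> has norm one, \<open>\<mu>\<^sub>A\<close> is not zero, so it is given by its defining
  formula.
\<close>

section \<open>Scaling of the Hausdorff measure under similarities\<close>

lemma diameter_similarity:
  fixes T :: "'a::metric_space \<Rightarrow> 'b::metric_space"
  assumes "r > 0" and T: "\<And>x y. dist (T x) (T y) = r * dist x y" and U: "bounded U"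
  shows "bounded (T ` U)" and "diameter (T ` U) = r * diameter U"
proof -
  obtain a e where e: "\<forall>y\<in>U. dist a y \<le> e"
    using U by (auto simp: bounded_def)
  have "\<forall>y\<in>T ` U. dist (T a) y \<le> r * e"
    using e \<open>r > 0\<close> by (auto simp: T)
  then show bT: "bounded (T ` U)"
    unfolding bounded_def by blast
  show "diameter (T ` U) = r * diameter U"
  proof (cases "U = {}")
    case False
    have "diameter (T ` U) \<le> r * diameter U"
      using False diameter_bounded_bound[OF U] \<open>r > 0\<close>
      by (auto simp: diameter_def[of "T ` U"] T intro!: cSUP_least)
    moreover have "diameter U \<le> diameter (T ` U) / r"
    proof -
      have "dist x y \<le> diameter (T ` U) / r" if "x \<in> U" "y \<in> U" for x y
        using diameter_bounded_bound[OF bT, of "T x" "T y"] that \<open>r > 0\<close>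
        by (simp add: T field_simps)
      then show ?thesis
        using False by (auto simp: diameter_def[of U] intro!: cSUP_least)
    qed
    ultimately show ?thesis
      using \<open>r > 0\<close> by (simp add: field_simps)
  qed simp
qed

lemma hausdorff_gauge_similarity:
  fixes T :: "'a::metric_space \<Rightarrow> 'b::metric_space"
  assumes "r > 0" and T: "\<And>x y. dist (T x) (T y) = r * dist x y" and U: "bounded U"
  shows "hausdorff_gauge s (T ` U) = ennreal (r powr s) * hausdorff_gauge s U"
  using diameter_similarity(2)[OF assms] diameter_ge_0[OF U] \<open>r > 0\<close>
  by (auto simp: hausdorff_gauge_def powr_mult ennreal_mult)

lemma hausdorff_outer_similarity_le:
  fixes T :: "'a::metric_space \<Rightarrow> 'b::metric_space"
  assumes "r > 0" and T: "\<And>x y. dist (T x) (T y) = r * dist x y"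
  shows "hausdorff_outer s (T ` E) \<le> ennreal (r powr s) * hausdorff_outer s E"
proof -
  define cov :: "real \<Rightarrow> 'a set \<Rightarrow> (nat \<Rightarrow> 'a set) set" where
    "cov d E = {U. (\<forall>i. bounded (U i) \<and> diameter (U i) \<le> d) \<and> E \<subseteq> (\<Union>i. U i)}" for d E
  define cov' :: "real \<Rightarrow> 'b set \<Rightarrow> (nat \<Rightarrow> 'b set) set" where
    "cov' d E = {U. (\<forall>i. bounded (U i) \<and> diameter (U i) \<le> d) \<and> E \<subseteq> (\<Union>i. U i)}" for d E
  have inverse: "ennreal (r powr - s) * ennreal (r powr s) = 1"
    using \<open>r > 0\<close> by (simp add: ennreal_mult[symmetric] powr_add[symmetric])
  have "(INF U\<in>cov' d (T ` E). \<Sum>i. hausdorff_gauge s (U i)) \<le> ennreal (r powr s) * hausdorff_outer s E"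
    if "d > 0" for d
  proof -
    let ?I = "INF U\<in>cov' d (T ` E). \<Sum>i. hausdorff_gauge s (U i)"
    have "ennreal (r powr - s) * ?I \<le> (INF U\<in>cov (d / r) E. \<Sum>i. hausdorff_gauge s (U i))"
    proof (rule INF_greatest)
      fix U assume U: "U \<in> cov (d / r) E"
      have bU: "bounded (U i)" for i
        using U by (simp add: cov_def)
      \<comment> \<open>Covers of \<open>E\<close> of mesh \<open>d / r\<close> correspond to covers of \<open>T ` E\<close> of mesh \<open>d\<close>.\<close>
      have "(\<lambda>i. T ` U i) \<in> cov' d (T ` E)"
        using U diameter_similarity[OF assms bU] \<open>r > 0\<close>
        by (simp add: cov_def cov'_def field_simps image_UN[symmetric] image_mono)
      then have "?I \<le> (\<Sum>i. hausdorff_gauge s (T ` U i))"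
        by (rule INF_lower)
      also have "\<dots> = ennreal (r powr s) * (\<Sum>i. hausdorff_gauge s (U i))"
        by (simp add: hausdorff_gauge_similarity[OF assms bU])
      finally have "ennreal (r powr - s) * ?I
          \<le> ennreal (r powr - s) * (ennreal (r powr s) * (\<Sum>i. hausdorff_gauge s (U i)))"
        by (rule mult_left_mono) simp
      then show "ennreal (r powr - s) * ?I \<le> (\<Sum>i. hausdorff_gauge s (U i))"
        by (simp only: mult.assoc[symmetric] inverse) simp
    qed
    also have "\<dots> \<le> hausdorff_outer s E"
      unfolding hausdorff_outer_def cov_def using that \<open>r > 0\<close> by (intro SUP_upper) auto
    finally have "ennreal (r powr s) * (ennreal (r powr - s) * ?I)
        \<le> ennreal (r powr s) * hausdorff_outer s E"
      by (rule mult_left_mono) simp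
    then show ?thesis
      using inverse by (simp add: mult.assoc[symmetric] mult.commute)
  qed
  then show ?thesis
    unfolding hausdorff_outer_def[of s "T ` E"] cov'_def by (intro SUP_least) auto
qed

lemma hausdorff_outer_similarity:
  fixes T :: "'a::metric_space \<Rightarrow> 'b::metric_space"
  assumes "r > 0" and T: "\<And>x y. dist (T x) (T y) = r * dist x y" and "surj T"
  shows "hausdorff_outer s (T ` E) = ennreal (r powr s) * hausdorff_outer s E"
proof (rule antisym)
  have "inj T"
    using T \<open>r > 0\<close> by (metis dist_eq_0_iff injI less_numeral_extra(3) mult_eq_0_iff)
  define S where "S = inv T"
  have TS: "T (S y) = y" and ST: "S (T x) = x" for x y
    using \<open>inj T\<close> \<open>surj T\<close> by (auto simp: S_def surj_f_inv_f)
  have "dist (S x) (S y) = (1 / r) * dist x y" for x y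
    using T[of "S x" "S y"] \<open>r > 0\<close> by (simp add: TS)
  from hausdorff_outer_similarity_le[OF _ this, of s "T ` E"]
  have "hausdorff_outer s E \<le> ennreal ((1 / r) powr s) * hausdorff_outer s (T ` E)"
    using \<open>r > 0\<close> by (simp add: image_image ST)
  then have "ennreal (r powr s) * hausdorff_outer s E
      \<le> ennreal (r powr s) * (ennreal ((1 / r) powr s) * hausdorff_outer s (T ` E))"
    by (rule mult_left_mono) simp
  also have "\<dots> = hausdorff_outer s (T ` E)"
    using \<open>r > 0\<close> by (simp add: mult.assoc[symmetric] ennreal_mult[symmetric] powr_mult[symmetric])
  finally show "ennreal (r powr s) * hausdorff_outer s E \<le> hausdorff_outer s (T ` E)" .
qed (rule hausdorff_outer_similarity_le[OF assms(1,2)])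

text \<open>
  By the way measures are constructed from set functions, the second alternative is the outcome
  when the outer measure fails to be countably additive on Borel sets.  Scaling holds in both
  cases, so the Caratheodory criterion for the outer measure is not needed.
\<close>

lemma emeasure_hausdorff_measure_cases:
  shows "(\<forall>E\<in>sets borel. emeasure (hausdorff_measure s) E = hausdorff_outer s (E :: 'a::metric_space set))
    \<or> (\<forall>E\<in>sets borel. emeasure (hausdorff_measure s) (E :: 'a set) = 0)"
  unfolding hausdorff_measure_def emeasure_measure_of_conv
  using sets.sigma_sets_eq[of "borel :: 'a measure"] by auto

lemma space_hausdorff_measure [simp]: "space (hausdorff_measure s) = UNIV"
  by (simp add: hausdorff_measure_def)

lemma sets_hausdorff_measure [simp]: "sets (hausdorff_measure s :: 'a::metric_space measure) = sets borel"
  using sets.sigma_sets_eq[of "borel :: 'a measure"]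
  by (simp add: hausdorff_measure_def)

lemma measurable_hausdorff_measure [simp]:
  "measurable (hausdorff_measure s :: 'a::metric_space measure) M = measurable borel M"
  "measurable M (hausdorff_measure s :: 'a measure) = measurable M borel"
  by (auto intro!: measurable_cong_sets)

lemma similarity_measurable:
  fixes T :: "'a::metric_space \<Rightarrow> 'b::metric_space"
  assumes "r > 0" and T: "\<And>x y. dist (T x) (T y) = r * dist x y"
  shows "T \<in> borel_measurable borel"
proof -
  have "lipschitz_on r UNIV T"
    using \<open>r > 0\<close> by (auto simp: lipschitz_on_def T)
  then show ?thesis
    by (intro borel_measurable_continuous_onI lipschitz_on_continuous_on)
qed

lemma emeasure_hausdorff_measure_similarity:
  fixes T :: "'a::metric_space \<Rightarrow> 'a"
  assumes "r > 0" and T: "\<And>x y. dist (T x) (T y) = r * dist x y" and "surj T"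
    and E: "E \<in> sets borel"
  shows "emeasure (hausdorff_measure s) E
    = ennreal (r powr s) * emeasure (hausdorff_measure s) (T -` E)"
proof -
  have E': "T -` E \<in> sets borel"
    using measurable_sets_borel[OF similarity_measurable[OF assms(1,2)] E] .
  have "T ` (T -` E) = E"
    using \<open>surj T\<close> by (simp add: surj_image_vimage_eq)
  then show ?thesis
    using emeasure_hausdorff_measure_cases[of s, where 'a='a] E E'
      hausdorff_outer_similarity[OF assms(1-3), of s "T -` E"] by auto
qed

text \<open>
  The function \<open>g\<close> is not assumed to be measurable: simple functions below \<open>g\<close> are pulled
  back along \<open>T\<close> to simple functions below \<open>g \<circ> T\<close>.  For an invertible \<open>T\<close> the
  two inequalities, for \<open>T\<close> and its inverse, give equality.
\<close>

lemma nn_integral_scaled_le: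
  assumes T: "T \<in> measurable M M'"
    and scale: "\<And>E. E \<in> sets M' \<Longrightarrow> c * emeasure M' E = emeasure M (T -` E \<inter> space M)"
  shows "c * (\<integral>\<^sup>+y. g y \<partial>M') \<le> (\<integral>\<^sup>+x. g (T x) \<partial>M)"
proof -
  have "c * integral\<^sup>S M' u \<le> (\<integral>\<^sup>+x. g (T x) \<partial>M)" if u: "simple_function M' u" "u \<le> g" for u
  proof -
    have [measurable]: "u \<in> borel_measurable M'"
      using u(1) by (rule borel_measurable_simple_function)
    have "distr M M' T = density M' (\<lambda>_. c)"
      using T by (intro measure_eqI) (auto simp: emeasure_distr emeasure_density_const scale)
    then have "(\<integral>\<^sup>+y. u y \<partial>distr M M' T) = (\<integral>\<^sup>+y. u y \<partial>density M' (\<lambda>_. c))"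
      by simp
    then have "(\<integral>\<^sup>+x. u (T x) \<partial>M) = c * (\<integral>\<^sup>+y. u y \<partial>M')"
      by (subst (asm) (1) nn_integral_distr[OF T], simp)
         (subst (asm) nn_integral_density; simp add: nn_integral_cmult)
    then have "c * integral\<^sup>S M' u = (\<integral>\<^sup>+x. u (T x) \<partial>M)"
      by (simp add: nn_integral_eq_simple_integral[OF u(1)])
    also have "\<dots> \<le> (\<integral>\<^sup>+x. g (T x) \<partial>M)"
      using u(2) by (intro nn_integral_mono) (auto simp: le_fun_def)
    finally show ?thesis .
  qed
  then show ?thesis
    by (auto simp: nn_integral_def[of M'] SUP_mult_left_ennreal intro!: SUP_least)
qed

lemma nn_integral_hausdorff_measure_similarity:
  fixes T :: "'a::metric_space \<Rightarrow> 'a" and g :: "'a \<Rightarrow> ennreal"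
  assumes "r > 0" and T: "\<And>x y. dist (T x) (T y) = r * dist x y" and "surj T"
  shows "(\<integral>\<^sup>+y. g y \<partial>hausdorff_measure s)
    = ennreal (r powr s) * (\<integral>\<^sup>+x. g (T x) \<partial>hausdorff_measure s)"
proof (rule antisym)
  let ?H = "hausdorff_measure s :: 'a measure"
  have inverse: "ennreal (r powr s) * ennreal ((1 / r) powr s) = 1"
    using \<open>r > 0\<close> by (simp add: ennreal_mult[symmetric] powr_mult[symmetric])
  have "inj T"
    using T \<open>r > 0\<close> by (metis dist_eq_0_iff injI less_numeral_extra(3) mult_eq_0_iff)
  define S where "S = inv T"
  have TS: "T (S y) = y" and ST: "S (T x) = x" for x y
    using \<open>inj T\<close> \<open>surj T\<close> by (auto simp: S_def surj_f_inv_f)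
  have S: "dist (S x) (S y) = (1 / r) * dist x y" for x y
    using T[of "S x" "S y"] \<open>r > 0\<close> by (simp add: TS)
  have "1 / r > 0" "surj S"
    using \<open>r > 0\<close> surjI[of S T, OF ST] by simp_all
  have T_scale: "emeasure ?H E = ennreal (r powr s) * emeasure ?H (T -` E)" if "E \<in> sets borel" for E
    using emeasure_hausdorff_measure_similarity[OF assms that] .
  have S_scale: "emeasure ?H E = ennreal ((1 / r) powr s) * emeasure ?H (S -` E)"
    if "E \<in> sets borel" for E
    using emeasure_hausdorff_measure_similarity[OF \<open>1 / r > 0\<close> S \<open>surj S\<close> that] .
  have "ennreal ((1 / r) powr s) * (\<integral>\<^sup>+y. g y \<partial>?H) \<le> (\<integral>\<^sup>+x. g (T x) \<partial>?H)"
    using similarity_measurable[OF assms(1,2)] inverse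
    by (intro nn_integral_scaled_le) (auto simp: T_scale mult.assoc[symmetric] mult.commute)
  then have "ennreal (r powr s) * (ennreal ((1 / r) powr s) * (\<integral>\<^sup>+y. g y \<partial>?H))
      \<le> ennreal (r powr s) * (\<integral>\<^sup>+x. g (T x) \<partial>?H)"
    by (rule mult_left_mono) simp
  then show "(\<integral>\<^sup>+y. g y \<partial>?H) \<le> ennreal (r powr s) * (\<integral>\<^sup>+x. g (T x) \<partial>?H)"
    by (simp only: mult.assoc[symmetric] inverse) simp
  have "ennreal (r powr s) * (\<integral>\<^sup>+x. g (T x) \<partial>?H) \<le> (\<integral>\<^sup>+y. g (T (S y)) \<partial>?H)"
    using similarity_measurable[OF \<open>1 / r > 0\<close> S] inverse
    by (intro nn_integral_scaled_le) (auto simp: S_scale mult.assoc[symmetric])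
  then show "ennreal (r powr s) * (\<integral>\<^sup>+x. g (T x) \<partial>?H) \<le> (\<integral>\<^sup>+y. g y \<partial>?H)"
    by (simp add: TS)
qed

section \<open>Square-integrable functions\<close>

lemma borel_measurable_cnj [measurable (raw)]:
  assumes "f \<in> borel_measurable M"
  shows "(\<lambda>x. cnj (f x)) \<in> borel_measurable M"
  using assms
  by (rule measurable_compose) (intro borel_measurable_continuous_onI continuous_intros)

lemma L2_inner_integrable:
  assumes "f \<in> L2 M" "g \<in> L2 M"
  shows "integrable M (\<lambda>x. f x * cnj (g x))"
proof (rule Bochner_Integration.integrable_bound)
  show "integrable M (\<lambda>x. (cmod (f x))\<^sup>2 + (cmod (g x))\<^sup>2)"
    using assms by (simp add: L2_def)
  have [measurable]: "f \<in> borel_measurable M" "g \<in> borel_measurable M"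
    using assms by (auto simp: L2_def)
  show "(\<lambda>x. f x * cnj (g x)) \<in> borel_measurable M"
    by measurable
  have "a * b \<le> a\<^sup>2 + b\<^sup>2" if "a \<ge> 0" "b \<ge> 0" for a b :: real
    using sum_squares_bound[of a b] mult_nonneg_nonneg[OF that] by simp
  then show "AE x in M. norm (f x * cnj (g x)) \<le> norm ((cmod (f x))\<^sup>2 + (cmod (g x))\<^sup>2)"
    by (simp add: norm_mult)
qed

lemma L2_diff:
  assumes "f \<in> L2 M" "g \<in> L2 M"
  shows "(\<lambda>x. f x - g x) \<in> L2 M"
proof -
  have [measurable]: "f \<in> borel_measurable M" "g \<in> borel_measurable M"
    using assms by (auto simp: L2_def)
  have "integrable M (\<lambda>x. (cmod (f x - g x))\<^sup>2)"
  proof (rule Bochner_Integration.integrable_bound)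
    show "integrable M (\<lambda>x. 2 * (cmod (f x))\<^sup>2 + 2 * (cmod (g x))\<^sup>2)"
      using assms by (simp add: L2_def)
    have "(cmod (a - b))\<^sup>2 \<le> 2 * (cmod a)\<^sup>2 + 2 * (cmod b)\<^sup>2" for a b
    proof -
      have "(cmod (a - b))\<^sup>2 \<le> (cmod a + cmod b)\<^sup>2"
        by (intro power_mono norm_triangle_ineq4) simp
      then show ?thesis
        using sum_squares_bound[of "cmod a" "cmod b"] by (simp add: power2_sum)
    qed
    then show "AE x in M. norm ((cmod (f x - g x))\<^sup>2)
        \<le> norm (2 * (cmod (f x))\<^sup>2 + 2 * (cmod (g x))\<^sup>2)"
      by simp
  qed measurable
  then show ?thesis
    by (simp add: L2_def)
qed

text \<open>Applied to \<open>f = h - h'\<close>, the hypothesis says that \<open>h - h'\<close> has norm \<open>0\<close>.\<close>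

lemma L2_inner_unique:
  assumes h: "h \<in> L2 M" "h' \<in> L2 M"
    and eq: "\<And>f. f \<in> L2 M \<Longrightarrow> L2_inner M f h = L2_inner M f h'"
  shows "AE x in M. h x = h' x"
proof -
  let ?d = "\<lambda>x. h x - h' x"
  have d: "?d \<in> L2 M"
    using h by (rule L2_diff)
  have "complex_of_real (\<integral>x. (cmod (?d x))\<^sup>2 \<partial>M) = (\<integral>x. ?d x * cnj (?d x) \<partial>M)"
    by (simp only: complex_norm_square[symmetric] integral_complex_of_real)
  also have "\<dots> = (\<integral>x. ?d x * cnj (h x) - ?d x * cnj (h' x) \<partial>M)"
    by (simp add: right_diff_distrib)
  also have "\<dots> = L2_inner M ?d h - L2_inner M ?d h'"
    unfolding L2_inner_def
    by (intro Bochner_Integration.integral_diff L2_inner_integrable d h)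
  finally have "(\<integral>x. (cmod (?d x))\<^sup>2 \<partial>M) = 0"
    using eq[OF d] by simp
  moreover have "integrable M (\<lambda>x. (cmod (?d x))\<^sup>2)"
    using d by (simp add: L2_def)
  ultimately show ?thesis
    by (subst (asm) integral_nonneg_eq_0_iff_AE) auto
qed

lemma L2_adjoint_AE:
  assumes h: "h \<in> L2 M" and adj: "\<And>f. f \<in> L2 M \<Longrightarrow> L2_inner M (T f) g = L2_inner M f h"
  shows "L2_adjoint M T g \<in> L2 M" and "AE x in M. L2_adjoint M T g x = h x"
proof -
  have "L2_adjoint M T g \<in> L2 M
      \<and> (\<forall>f\<in>L2 M. L2_inner M (T f) g = L2_inner M f (L2_adjoint M T g))"
    unfolding L2_adjoint_def by (rule someI[where x = h]) (use h adj in auto)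
  then show "L2_adjoint M T g \<in> L2 M" and "AE x in M. L2_adjoint M T g x = h x"
    using h adj by (auto intro!: L2_inner_unique)
qed

lemma proj_measure_eq_density:
  assumes g: "g \<in> L2 M"
  shows "proj_measure M g = density M (\<lambda>x. ennreal ((cmod (g x))\<^sup>2))"
proof -
  have [measurable]: "g \<in> borel_measurable M" and int: "integrable M (\<lambda>x. (cmod (g x))\<^sup>2)"
    using g by (auto simp: L2_def)
  let ?D = "density M (\<lambda>x. ennreal ((cmod (g x))\<^sup>2))"
  have "ennreal (Re (L2_inner M g (mult_proj E g))) = emeasure ?D E" if E: "E \<in> sets M" for E
  proof -
    have intE: "integrable M (\<lambda>x. (cmod (g x))\<^sup>2 * indicator E x)"
      using int E by (rule integrable_real_mult_indicator[rotated])
    have "L2_inner M g (mult_proj E g) = (\<integral>x. complex_of_real ((cmod (g x))\<^sup>2 * indicator E x) \<partial>M)"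
      unfolding L2_inner_def mult_proj_def
      by (intro Bochner_Integration.integral_cong)
         (auto simp: complex_norm_square indicator_def simp del: of_real_power)
    then have "Re (L2_inner M g (mult_proj E g)) = (\<integral>x. (cmod (g x))\<^sup>2 * indicator E x \<partial>M)"
      by (simp del: of_real_power of_real_mult)
    then have "ennreal (Re (L2_inner M g (mult_proj E g)))
        = (\<integral>\<^sup>+x. ennreal ((cmod (g x))\<^sup>2 * indicator E x) \<partial>M)"
      using nn_integral_eq_integral[OF intE] by simp
    also have "\<dots> = emeasure ?D E"
      using E by (simp add: emeasure_density ennreal_mult ennreal_indicator)
    finally show ?thesis .
  qed
  then have "proj_measure M g = measure_of (space M) (sets M) (emeasure ?D)"
    unfolding proj_measure_def
    by (intro measure_of_eq sets.space_closed) (simp add: sets.sigma_sets_eq)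
  also have "\<dots> = ?D"
    using measure_of_of_measure[of ?D] by simp
  finally show ?thesis .
qed

lemma integral_proj_measure:
  fixes \<psi> :: "'a \<Rightarrow> complex"
  assumes g: "g \<in> L2 M" and \<psi>: "\<psi> \<in> borel_measurable M"
  shows "(\<integral>x. \<psi> x \<partial>proj_measure M g) = (\<integral>x. (cmod (g x))\<^sup>2 *\<^sub>R \<psi> x \<partial>M)"
proof -
  have [measurable]: "g \<in> borel_measurable M"
    using g by (auto simp: L2_def)
  show ?thesis
    unfolding proj_measure_eq_density[OF g] using \<psi> by (intro integral_density) auto
qed

section \<open>The sequence space and the maps prepending a symbol\<close>

lemma prepend_0 [simp]: "prepend k x 0 = k"
  and prepend_Suc [simp]: "prepend k x (Suc n) = x n"
  by (simp_all add: prepend_def)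

lemma shift_prepend [simp]: "shift (prepend k x) = x"
  by (simp add: shift_def)

lemma prepend_shift: "x 0 = k \<Longrightarrow> prepend k (shift x) = x"
  by (auto simp: prepend_def shift_def split: nat.split)

lemma prepend_in_Ran: "k < N \<Longrightarrow> x \<in> Dom N A k \<Longrightarrow> prepend k x \<in> Ran N A k"
  by (auto simp: Dom_def Ran_def Lam_def prepend_def split: nat.split)

lemma shift_in_Dom: "x \<in> Ran N A k \<Longrightarrow> shift x \<in> Dom N A k"
  by (auto simp: Dom_def Ran_def Lam_def shift_def)

lemma Dom_subset: "Dom N A k \<subseteq> Lam N A"
  and Ran_subset: "Ran N A k \<subseteq> Lam N A"
  by (auto simp: Dom_def Ran_def)

lemma Dom_Int_Lam [simp]: "Dom N A k \<inter> Lam N A = Dom N A k"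
  and Ran_Int_Lam [simp]: "Ran N A k \<inter> Lam N A = Ran N A k"
  using Dom_subset Ran_subset by (auto simp: Int_absorb2)

lemma continuous_prepend: "continuous_on UNIV (prepend k)"
proof (rule continuous_on_coordinatewise_then_product)
  show "continuous_on UNIV (\<lambda>x. prepend k x i)" for i
    by (cases i) (auto intro!: continuous_intros continuous_on_product_coordinates)
qed

lemma continuous_shift: "continuous_on UNIV shift"
  unfolding shift_def
  by (intro continuous_on_coordinatewise_then_product continuous_on_product_coordinates)

lemma measurable_prepend [measurable]: "prepend k \<in> borel_measurable borel"
  and measurable_shift [measurable]: "shift \<in> borel_measurable borel"
  by (intro borel_measurable_continuous_onI continuous_prepend continuous_shift)+

lemma measurable_coordinate [measurable]:
  "(\<lambda>x :: nat \<Rightarrow> nat. x i) \<in> measurable borel (count_space UNIV)"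
  using borel_measurable_continuous_onI[OF continuous_on_product_coordinates, of i, where 'b=nat]
  by (simp add: measurable_cong_sets[OF refl sets_borel_eq_count_space])

lemma measurable_val [measurable]: "val N \<in> borel_measurable borel"
proof -
  have [measurable]: "(\<lambda>x :: nat \<Rightarrow> nat. real (x i)) \<in> borel_measurable borel" for i
    by measurable
  show ?thesis
    unfolding val_def[abs_def] by measurable
qed

lemma summable_val:
  assumes "N \<ge> 2" "x \<in> Lam N A"
  shows "summable (\<lambda>i. real (x i) / real N ^ Suc i)"
proof (rule summable_comparison_test')
  show "summable (\<lambda>i. (1 / real N) ^ i)"
    using assms by (intro summable_geometric) auto
  fix i
  have "real (x i) \<le> real N"
    using assms by (auto simp: Lam_def less_imp_le)
  then show "norm (real (x i) / real N ^ Suc i) \<le> (1 / real N) ^ i"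
    using assms by (simp add: field_simps)
qed

lemma val_prepend:
  assumes "N \<ge> 2" "x \<in> Lam N A"
  shows "val N (prepend k x) = (val N x + real k) / real N"
proof -
  let ?y = "prepend k x"
  have 1: "summable (\<lambda>i. real (?y (Suc i)) / real N ^ Suc (Suc i))"
    using summable_divide[OF summable_val[OF assms], of "real N"] by (simp add: field_simps)
  then have "val N ?y = real k / real N + (\<Sum>i. real (x i) / real N ^ Suc i / real N)"
    using suminf_split_head[of "\<lambda>i. real (?y i) / real N ^ Suc i"]
      summable_Suc_iff[of "\<lambda>i. real (?y i) / real N ^ Suc i"]
    by (simp add: val_def field_simps)
  also have "(\<Sum>i. real (x i) / real N ^ Suc i / real N) = val N x / real N"
    unfolding val_def by (rule suminf_divide[OF summable_val[OF assms]])
  finally show ?thesis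
    by (simp add: add_divide_distrib)
qed

lemma val_bounds:
  assumes "N \<ge> 2" "x \<in> Lam N A"
  shows "val N x \<in> {0..1}"
proof -
  have sums: "(\<lambda>i. (real N - 1) / real N * (1 / real N) ^ i) sums 1"
    using sums_mult[OF geometric_sums[of "1 / real N"], of "(real N - 1) / real N"] assms(1)
    by (simp add: field_simps)
  have "real (x i) / real N ^ Suc i \<le> (real N - 1) / real N * (1 / real N) ^ i" for i
  proof -
    have "x i < N" using assms by (auto simp: Lam_def)
    then have "real (x i) \<le> real N - 1" by linarith
    then show ?thesis using assms(1) by (simp add: field_simps)
  qed
  then have "val N x \<le> (\<Sum>i. (real N - 1) / real N * (1 / real N) ^ i)"
    unfolding val_def by (intro suminf_le summable_val[OF assms] sums_summable[OF sums])
  also have "\<dots> = 1"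
    using sums_unique[OF sums] by (rule sym)
  finally have "val N x \<le> 1" .
  then show ?thesis
    using suminf_nonneg[OF summable_val[OF assms]] by (simp add: val_def)
qed

lemma compact_Lam: "compact (Lam N A)"
proof -
  have "compactin (product_topology (\<lambda>_::nat. euclidean :: nat topology) UNIV) (PiE UNIV (\<lambda>_. {..<N}))"
    by (auto simp: compactin_PiE intro: finite_imp_compact)
  then have "compact (PiE UNIV (\<lambda>_::nat. {..<N}))"
    by (simp add: euclidean_product_topology)
  moreover have "closed {x. A (x i) (x (Suc i)) = 1}" for i
  proof -
    have "continuous_on UNIV (\<lambda>x :: nat \<Rightarrow> nat. (x i, x (Suc i)))"
      by (intro continuous_intros continuous_on_product_coordinates)
    moreover have "closed {p :: nat \<times> nat. A (fst p) (snd p) = 1}"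
    proof -
      have "open (S :: (nat \<times> nat) set)" for S
      proof -
        have "open (\<Union>p\<in>S. {fst p} \<times> {snd p})"
          by (intro open_UN open_Times ballI open_discrete)
        then show ?thesis by simp
      qed
      then show ?thesis by (simp add: closed_def)
    qed
    ultimately have "closed ((\<lambda>x. (x i, x (Suc i))) -` {p. A (fst p) (snd p) = 1})"
      by (intro closed_vimage)
    then show ?thesis by (simp add: vimage_def)
  qed
  ultimately have "compact (PiE UNIV (\<lambda>_::nat. {..<N}) \<inter> (\<Inter>i. {x. A (x i) (x (Suc i)) = 1}))"
    by (intro compact_Int_closed closed_INT) auto
  also have "PiE UNIV (\<lambda>_::nat. {..<N}) \<inter> (\<Inter>i. {x. A (x i) (x (Suc i)) = 1}) = Lam N A"
    by (auto simp: Lam_def)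
  finally show ?thesis .
qed

section \<open>Scaling of the measure on the sequence space\<close>

lemma space_muA [simp]: "space (muA N A) = Lam N A"
  using sets.space_closed[of "restrict_space borel (Lam N A)"]
  by (simp add: muA_def space_measure_of_conv)

lemma sets_muA: "sets (muA N A) = sets (restrict_space borel (Lam N A))"
  using sets.sigma_sets_eq[of "restrict_space borel (Lam N A)"] sets.space_closed[of "restrict_space borel (Lam N A)"]
  by (simp add: muA_def sets_measure_of_conv space_restrict_space)

lemma measurable_muA:
  assumes "g \<in> measurable borel M"
  shows "g \<in> measurable (muA N A) M"
  using measurable_restrict_space1[OF assms, of "Lam N A"]
  by (simp add: measurable_cong_sets[OF sets_muA refl])

lemma measurable_shift_muA: "shift \<in> measurable (muA N A) (muA N A)"
  unfolding measurable_cong_sets[OF sets_muA sets_muA]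
  by (rule measurable_restrict_space3) (auto simp: Lam_def shift_def)

lemma Dom_sets [measurable, simp]: "Dom N A k \<in> sets (muA N A)"
proof -
  have "{x :: nat \<Rightarrow> nat. A k (x 0) = 1} \<in> sets borel"
    by measurable
  then have "Lam N A \<inter> {x. A k (x 0) = 1} \<in> sets (muA N A)"
    unfolding sets_muA sets_restrict_space by (rule imageI)
  then show ?thesis
    by (simp add: Dom_def Int_def)
qed

lemma Ran_sets [measurable, simp]: "Ran N A k \<in> sets (muA N A)"
proof -
  have "{x :: nat \<Rightarrow> nat. x 0 = k} \<in> sets borel"
    by measurable
  then have "Lam N A \<inter> {x. x 0 = k} \<in> sets (muA N A)"
    unfolding sets_muA sets_restrict_space by (rule imageI)
  then show ?thesis
    by (simp add: Ran_def Int_def)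
qed

text \<open>
  If the defining set function of \<^const>\<open>muA\<close> were not a measure, \<^const>\<open>muA\<close>
  would be the zero measure; nontriviality therefore gives access to the defining formula.
  The restriction to \<open>{0..1}\<close> can be dropped because all values lie there.
\<close>

lemma emeasure_muA:
  assumes "N \<ge> 2" and nontrivial: "emeasure (muA N A) (Lam N A) \<noteq> 0"
    and B: "B \<in> sets (muA N A)"
  shows "emeasure (muA N A) B
    = (\<integral>\<^sup>+y. emeasure (count_space UNIV) {w \<in> B. val N w = y} \<partial>hausdorff_measure (dimA N A))"
proof -
  let ?\<mu> = "\<lambda>B. \<integral>\<^sup>+y\<in>{0..1}. emeasure (count_space UNIV) {w \<in> B. val N w = y}
            \<partial>hausdorff_measure (dimA N A)"
  let ?S = "sets (restrict_space borel (Lam N A))"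
  have S: "sigma_sets (Lam N A) ?S = ?S"
    using sets.sigma_sets_eq[of "restrict_space borel (Lam N A)"] by (simp add: space_restrict_space)
  have "measure_space (Lam N A) ?S ?\<mu>"
    using nontrivial unfolding muA_def emeasure_measure_of_conv S by (auto split: if_splits)
  then have "emeasure (muA N A) B = ?\<mu> B"
    using B unfolding sets_muA unfolding muA_def emeasure_measure_of_conv S by simp
  also have "\<dots> = (\<integral>\<^sup>+y. emeasure (count_space UNIV) {w \<in> B. val N w = y} \<partial>hausdorff_measure (dimA N A))"
  proof (rule nn_integral_cong)
    fix y
    have "{w \<in> B. val N w = y} = {}" if "y \<notin> {0..1}"
      using that val_bounds[OF \<open>N \<ge> 2\<close>, of _ A] sets.sets_into_space[OF B] by auto
    then show "emeasure (count_space UNIV) {w \<in> B. val N w = y} * indicator {0..1} y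
        = emeasure (count_space UNIV) {w \<in> B. val N w = y}"
      by (cases "y \<in> {0..1}") (simp, simp only: emeasure_empty mult_zero_left not_False_eq_True)
  qed
  finally show ?thesis .
qed

lemma prepend_image_sets:
  assumes "k < N" and B: "B \<in> sets (muA N A)" "B \<subseteq> Dom N A k"
  shows "prepend k ` B \<in> sets (muA N A)"
proof -
  have "(shift -` B \<inter> space (muA N A)) \<inter> Ran N A k \<in> sets (muA N A)"
    using B by (intro sets.Int measurable_sets[OF measurable_shift_muA]) auto
  also have "(shift -` B \<inter> space (muA N A)) \<inter> Ran N A k = prepend k ` B"
    using B(2) prepend_in_Ran[OF \<open>k < N\<close>] Ran_subset[of N A k] prepend_shift[of _ k, symmetric]
    by (fastforce simp: Ran_def image_iff)
  finally show ?thesis .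
qed

text \<open>
  The map \<open>\<sigma>\<^sub>k\<close> carries the fibre of \<^term>\<open>val N\<close> over \<open>y\<close> onto the fibre
  over \<open>(y + k) / N\<close>, and \<open>y \<mapsto> (y + k) / N\<close> is a similarity of ratio \<open>1 / N\<close>.
\<close>

lemma emeasure_muA_prepend:
  assumes "N \<ge> 2" "k < N" and nontrivial: "emeasure (muA N A) (Lam N A) \<noteq> 0"
    and B: "B \<in> sets (muA N A)" "B \<subseteq> Dom N A k"
  shows "emeasure (muA N A) (prepend k ` B)
    = ennreal ((1 / real N) powr dimA N A) * emeasure (muA N A) B"
proof -
  let ?H = "hausdorff_measure (dimA N A) :: real measure"
  define T where "T y = (y + real k) / real N" for y
  have T: "dist (T x) (T y) = (1 / real N) * dist x y" for x y
    using assms(1) by (simp add: T_def dist_real_def diff_divide_distrib[symmetric])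
  have "T (real N * y - real k) = y" for y
    using assms(1) by (simp add: T_def)
  then have "surj T"
    by (rule surjI)
  have fibre: "{w \<in> prepend k ` B. val N w = T y} = prepend k ` {w \<in> B. val N w = y}" for y
  proof -
    have "val N (prepend k w) = T y \<longleftrightarrow> val N w = y" if "w \<in> B" for w
      using that B(2) Dom_subset[of N A k] val_prepend[OF assms(1), of w A k] assms(1)
      by (auto simp: T_def)
    then show ?thesis by auto
  qed
  have inj: "inj_on (prepend k) X" for X
    by (rule inj_on_inverseI[of _ shift]) simp
  have "emeasure (muA N A) (prepend k ` B)
      = (\<integral>\<^sup>+y. emeasure (count_space UNIV) {w \<in> prepend k ` B. val N w = y} \<partial>?H)"
    by (rule emeasure_muA[OF assms(1) nontrivial prepend_image_sets[OF assms(2) B]])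
  also have "\<dots> = ennreal ((1 / real N) powr dimA N A) *
      (\<integral>\<^sup>+y. emeasure (count_space UNIV) {w \<in> prepend k ` B. val N w = T y} \<partial>?H)"
    using assms(1) by (intro nn_integral_hausdorff_measure_similarity T \<open>surj T\<close>) auto
  also have "(\<lambda>y. emeasure (count_space UNIV) {w \<in> prepend k ` B. val N w = T y})
      = (\<lambda>y. emeasure (count_space UNIV) {w \<in> B. val N w = y})"
    unfolding fibre
    by (intro ext) (simp add: emeasure_count_space finite_image_iff[OF inj] card_image[OF inj])
  also have "(\<integral>\<^sup>+y. emeasure (count_space UNIV) {w \<in> B. val N w = y} \<partial>?H) = emeasure (muA N A) B"
    by (rule emeasure_muA[OF assms(1) nontrivial B(1), symmetric])
  finally show ?thesis .
qed

section \<open>The weighted shifts and their adjoints\<close>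

text \<open>
  The systems whose measure does not vanish.  A function of positive norm exists only on these.
\<close>

locale nontrivial_system =
  fixes N :: nat and A :: "nat \<Rightarrow> nat \<Rightarrow> nat"
  assumes N: "N \<ge> 2" and nontrivial: "emeasure (muA N A) (Lam N A) \<noteq> 0"
begin

abbreviation "M \<equiv> muA N A"
abbreviation "MD k \<equiv> restrict_space M (Dom N A k)"
abbreviation "MR k \<equiv> restrict_space M (Ran N A k)"

text \<open>The factor \<open>N\<close> to the power \<open>- \<delta>\<^sub>A\<close> by which every \<open>\<sigma>\<^sub>k\<close> scales \<open>\<mu>\<^sub>A\<close>.\<close>

definition ratio :: real where
  "ratio = (1 / real N) powr dimA N A"

lemma ratio_pos: "ratio > 0"
  using N by (simp add: ratio_def)

lemma space_MD [simp]: "space (MD k) = Dom N A k"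
  and space_MR [simp]: "space (MR k) = Ran N A k"
  using Dom_subset[of N A k] Ran_subset[of N A k] by (auto simp: space_restrict_space)

lemma sets_MD: "B \<in> sets (MD k) \<longleftrightarrow> B \<in> sets M \<and> B \<subseteq> Dom N A k"
  and sets_MR: "B \<in> sets (MR k) \<longleftrightarrow> B \<in> sets M \<and> B \<subseteq> Ran N A k"
  by (auto simp: sets_restrict_space_iff)

lemma measurable_prepend_MD:
  assumes "k < N"
  shows "prepend k \<in> measurable (MD k) (MR k)"
proof (rule measurableI)
  show "prepend k x \<in> space (MR k)" if "x \<in> space (MD k)" for x
    using prepend_in_Ran[OF assms] that by simp
  fix B assume "B \<in> sets (MR k)"
  then have B: "B \<in> sets M" "B \<subseteq> Ran N A k"
    by (simp_all add: sets_MR)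
  then obtain C where C: "C \<in> sets borel" "B = Lam N A \<inter> C"
    unfolding sets_muA sets_restrict_space by auto
  have "prepend k -` C \<inter> UNIV \<in> sets borel"
    using measurable_sets[OF measurable_prepend C(1), of k] by simp
  then have "Lam N A \<inter> prepend k -` C \<in> sets M"
    by (auto simp: sets_muA sets_restrict_space)
  then have "(Lam N A \<inter> prepend k -` C) \<inter> Dom N A k \<in> sets M"
    by (rule sets.Int) (rule Dom_sets)
  also have "(Lam N A \<inter> prepend k -` C) \<inter> Dom N A k = prepend k -` B \<inter> space (MD k)"
    using prepend_in_Ran[OF assms, of _ A] Ran_subset[of N A k] Dom_subset[of N A k]
    by (auto simp: C(2))
  finally show "prepend k -` B \<inter> space (MD k) \<in> sets (MD k)"
    by (simp add: sets_MD)
qed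

lemma measurable_shift_MR: "shift \<in> measurable (MR k) (MD k)"
  by (rule measurable_restrict_space3[OF measurable_shift_muA]) (auto intro: shift_in_Dom)

text \<open>Change of variables: \<open>\<mu>\<^sub>A\<close> on \<open>R\<^sub>k\<close> is \<open>ratio\<close> times the image of \<open>\<mu>\<^sub>A\<close> on \<open>D\<^sub>k\<close>.\<close>

lemma distr_prepend:
  assumes "k < N"
  shows "distr (density (MD k) (\<lambda>_. ennreal ratio)) (MR k) (prepend k) = MR k"
proof (rule measure_eqI)
  fix B assume "B \<in> sets (distr (density (MD k) (\<lambda>_. ennreal ratio)) (MR k) (prepend k))"
  then have B: "B \<in> sets (MR k)" by simp
  let ?C = "prepend k -` B \<inter> Dom N A k"
  have C: "?C \<in> sets (MD k)"
    using measurable_sets[OF measurable_prepend_MD[OF assms] B] by simp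
  have "B \<subseteq> prepend k ` ?C"
  proof
    fix x assume "x \<in> B"
    then have "x \<in> Ran N A k" using B by (auto simp: sets_MR)
    then have "prepend k (shift x) = x" "shift x \<in> Dom N A k"
      by (auto intro: shift_in_Dom prepend_shift simp: Ran_def)
    then show "x \<in> prepend k ` ?C"
      using \<open>x \<in> B\<close> by (intro image_eqI[of _ _ "shift x"]) auto
  qed
  then have image: "prepend k ` ?C = B" by auto
  have "emeasure (distr (density (MD k) (\<lambda>_. ennreal ratio)) (MR k) (prepend k)) B
      = ennreal ratio * emeasure (MD k) ?C"
    using measurable_prepend_MD[OF assms] B C
    by (simp add: emeasure_distr emeasure_density_const)
  also have "\<dots> = ennreal ratio * emeasure M ?C"
    using C by (simp add: emeasure_restrict_space sets_MD)
  also have "\<dots> = emeasure M (prepend k ` ?C)"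
    using C emeasure_muA_prepend[OF N assms nontrivial, of ?C] by (simp add: sets_MD ratio_def)
  also have "\<dots> = emeasure (MR k) B"
    using B unfolding image by (simp add: emeasure_restrict_space sets_MR)
  finally show "emeasure (distr (density (MD k) (\<lambda>_. ennreal ratio)) (MR k) (prepend k)) B
      = emeasure (MR k) B" .
qed simp

lemma integral_MR:
  fixes F :: "(nat \<Rightarrow> nat) \<Rightarrow> 'b::{banach, second_countable_topology}"
  assumes "k < N" and F: "F \<in> borel_measurable (MR k)"
  shows "(\<integral>x. F x \<partial>MR k) = ratio *\<^sub>R (\<integral>x. F (prepend k x) \<partial>MD k)"
    and "integrable (MR k) F \<longleftrightarrow> integrable (MD k) (\<lambda>x. F (prepend k x))"
proof -
  note m = measurable_prepend_MD[OF \<open>k < N\<close>]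
  have m': "prepend k \<in> measurable (density (MD k) (\<lambda>_. ennreal ratio)) (MR k)"
    using m by simp
  have F': "(\<lambda>x. F (prepend k x)) \<in> borel_measurable (MD k)"
    using measurable_compose[OF m F] .
  have "(\<integral>x. F x \<partial>MR k) = (\<integral>x. F x \<partial>distr (density (MD k) (\<lambda>_. ennreal ratio)) (MR k) (prepend k))"
    by (simp only: distr_prepend[OF \<open>k < N\<close>])
  also have "\<dots> = (\<integral>x. F (prepend k x) \<partial>density (MD k) (\<lambda>_. ennreal ratio))"
    by (rule integral_distr[OF m' F])
  also have "\<dots> = ratio *\<^sub>R (\<integral>x. F (prepend k x) \<partial>MD k)"
    using F' ratio_pos by (subst integral_density) auto
  finally show "(\<integral>x. F x \<partial>MR k) = ratio *\<^sub>R (\<integral>x. F (prepend k x) \<partial>MD k)" .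
  have "integrable (MR k) F
      \<longleftrightarrow> integrable (distr (density (MD k) (\<lambda>_. ennreal ratio)) (MR k) (prepend k)) F"
    by (simp only: distr_prepend[OF \<open>k < N\<close>])
  also have "\<dots> \<longleftrightarrow> integrable (density (MD k) (\<lambda>_. ennreal ratio)) (\<lambda>x. F (prepend k x))"
    by (rule integrable_distr_eq[OF m' F])
  also have "\<dots> \<longleftrightarrow> integrable (MD k) (\<lambda>x. F (prepend k x))"
    using F' ratio_pos integrable_scaleR_right[of "1 / ratio" "MD k" "\<lambda>x. ratio *\<^sub>R F (prepend k x)"]
    by (subst integrable_density) auto
  finally show "integrable (MR k) F \<longleftrightarrow> integrable (MD k) (\<lambda>x. F (prepend k x))" .
qed

lemma muA_prepend_eq_density:
  assumes "k < N"
  shows "muA_prepend N A k = density (MD k) (\<lambda>_. ennreal ratio)"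
proof -
  let ?D = "density (MD k) (\<lambda>_. ennreal ratio)"
  have "emeasure M (prepend k ` B) = emeasure ?D B" if "B \<in> sets (MD k)" for B
    using that emeasure_muA_prepend[OF N assms nontrivial, of B]
    by (simp add: emeasure_density_const emeasure_restrict_space sets_MD ratio_def)
  then have "muA_prepend N A k = measure_of (space (MD k)) (sets (MD k)) (emeasure ?D)"
    unfolding muA_prepend_def space_MD
    using sets.space_closed[of "MD k"] sets.sigma_sets_eq[of "MD k"]
    by (intro measure_of_eq) simp_all
  also have "\<dots> = ?D"
    using measure_of_of_measure[of ?D] by simp
  finally show ?thesis .
qed

lemma measurable_MD: "g \<in> borel_measurable M \<Longrightarrow> g \<in> borel_measurable (MD k)"
  and measurable_MR: "g \<in> borel_measurable M \<Longrightarrow> g \<in> borel_measurable (MR k)"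
  by (rule measurable_restrict_space1, assumption)+

text \<open>
  Without \<open>\<sigma>\<close>-finiteness of \<open>\<mu>\<^sub>A\<close> the derivative need not be unique almost
  everywhere, but it is unique on the support of a square-integrable function, because
  \<open>ratio * |f|\<^sup>2\<close> has finite integral.
\<close>

lemma Phi_AE:
  assumes "k < N" and f: "f \<in> L2 M"
  shows "AE x in MD k. f x \<noteq> 0 \<longrightarrow> Phi N A k x = ennreal ratio"
proof -
  let ?w = "\<lambda>x. ennreal ((cmod (f x))\<^sup>2)"
  have [measurable]: "f \<in> borel_measurable (MD k)"
    using f by (intro measurable_MD) (simp add: L2_def)
  have Phi: "Phi N A k = RN_deriv (MD k) (density (MD k) (\<lambda>_. ennreal ratio))"
    by (simp add: Phi_def muA_prepend_eq_density[OF assms(1)])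
  then have [measurable]: "Phi N A k \<in> borel_measurable (MD k)"
    by simp
  have "integrable (MD k) (\<lambda>x. (cmod (f x))\<^sup>2)"
    using f integrable_mult_indicator[OF Dom_sets, of N A "\<lambda>x. (cmod (f x))\<^sup>2" k]
    by (simp add: L2_def integrable_restrict_space)
  then have "(\<integral>\<^sup>+x. ?w x \<partial>MD k) < \<infinity>"
    by (subst nn_integral_eq_integral) auto
  then have fin: "(\<integral>\<^sup>+x. ennreal ratio * ?w x \<partial>MD k) \<noteq> \<infinity>"
    by (simp add: nn_integral_cmult ennreal_mult_eq_top_iff)
  have "density (MD k) (Phi N A k) = density (MD k) (\<lambda>_. ennreal ratio)"
    unfolding Phi by (rule density_RN_deriv_density) simp
  then have "density (density (MD k) (\<lambda>_. ennreal ratio)) ?w = density (density (MD k) (Phi N A k)) ?w"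
    by simp
  then have "density (MD k) (\<lambda>x. ennreal ratio * ?w x) = density (MD k) (\<lambda>x. Phi N A k x * ?w x)"
    by (simp add: density_density_eq)
  then have "AE x in MD k. ennreal ratio * ?w x = Phi N A k x * ?w x"
    using fin by (subst (asm) finite_density_unique) auto
  then show ?thesis
  proof eventually_elim
    case (elim x)
    then have "?w x * ennreal ratio = ?w x * Phi N A k x"
      by (simp only: mult.commute)
    then show ?case
      by (subst (asm) ennreal_mult_cancel_left) auto
  qed
qed

text \<open>
  The function \<open>ratio\<^sup>1\<^sup>/\<^sup>2 \<sqdot> (g \<circ> \<sigma>\<^sub>k)\<close> on \<open>D\<^sub>k\<close>, extended by \<open>0\<close>; it
  represents \<open>S\<^sub>k\<^sup>* g\<close>.
\<close>

definition pullback :: "nat \<Rightarrow> ((nat \<Rightarrow> nat) \<Rightarrow> complex) \<Rightarrow> (nat \<Rightarrow> nat) \<Rightarrow> complex" where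
  "pullback k g = (\<lambda>x. if x \<in> Dom N A k then complex_of_real (sqrt ratio) * g (prepend k x) else 0)"

lemma pullback_L2:
  assumes "k < N" and g: "g \<in> L2 M"
  shows "pullback k g \<in> L2 M"
proof -
  have gM: "g \<in> borel_measurable M"
    using g by (simp add: L2_def)
  have [measurable]: "(\<lambda>x. g (prepend k x)) \<in> borel_measurable (MD k)"
    by (rule measurable_compose[OF measurable_prepend_MD[OF assms(1)] measurable_MR[OF gM]])
  have "(\<lambda>x. complex_of_real (sqrt ratio) * g (prepend k x)) \<in> borel_measurable (MD k)"
    by measurable
  then have "pullback k g \<in> borel_measurable M"
    unfolding pullback_def by (subst (asm) measurable_restrict_space_iff[where c = 0]) auto
  moreover have "integrable M (\<lambda>x. (cmod (pullback k g x))\<^sup>2)"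
  proof -
    have "integrable (MR k) (\<lambda>x. (cmod (g x))\<^sup>2)"
      using g integrable_mult_indicator[OF Ran_sets, of N A "\<lambda>x. (cmod (g x))\<^sup>2" k]
      by (simp add: L2_def integrable_restrict_space)
    then have "integrable (MD k) (\<lambda>x. (cmod (g (prepend k x)))\<^sup>2)"
      using measurable_MR[OF gM] by (subst (asm) integral_MR(2)[OF assms(1)]) auto
    then have "integrable (MD k) (\<lambda>x. ratio * (cmod (g (prepend k x)))\<^sup>2)"
      by simp
    then have "integrable M (\<lambda>x. indicator (Dom N A k) x *\<^sub>R (ratio * (cmod (g (prepend k x)))\<^sup>2))"
      by (subst (asm) integrable_restrict_space) auto
    also have "(\<lambda>x. indicator (Dom N A k) x *\<^sub>R (ratio * (cmod (g (prepend k x)))\<^sup>2))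
        = (\<lambda>x. (cmod (pullback k g x))\<^sup>2)"
      using ratio_pos by (auto simp: pullback_def norm_mult power_mult_distrib indicator_def)
    finally show ?thesis .
  qed
  ultimately show ?thesis
    by (simp add: L2_def)
qed

lemma S_op_adjoint:
  assumes "k < N" and f: "f \<in> L2 M" and g: "g \<in> L2 M"
  shows "L2_inner M (S_op N A k f) g = L2_inner M f (pullback k g)"
proof -
  let ?p = "\<lambda>x. complex_of_real (enn2real (Phi N A k x) powr (- 1 / 2))"
  have fM: "f \<in> borel_measurable M" and gM: "g \<in> borel_measurable M"
    using f g by (auto simp: L2_def)
  have [measurable]: "f \<in> borel_measurable (MD k)" "g \<in> borel_measurable (MR k)"
    using fM gM by (auto intro: measurable_MD measurable_MR)
  have [measurable]: "(\<lambda>x. g (prepend k x)) \<in> borel_measurable (MD k)"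
    by (rule measurable_compose[OF measurable_prepend_MD[OF assms(1)]]) measurable
  have [measurable]: "Phi N A k \<in> borel_measurable (MD k)"
    by (simp add: Phi_def)
  have pf[measurable]: "(\<lambda>x. ?p x * f x) \<in> borel_measurable (MD k)"
    by measurable
  have "(\<lambda>x. ?p (shift x) * f (shift x)) \<in> borel_measurable (MR k)"
    by (rule measurable_compose[OF measurable_shift_MR pf])
  then have F: "(\<lambda>x. ?p (shift x) * f (shift x) * cnj (g x)) \<in> borel_measurable (MR k)"
    by (rule borel_measurable_times) measurable
  have ae: "AE x in MD k. ?p x * f x = complex_of_real (1 / sqrt ratio) * f x"
    using Phi_AE[OF assms(1) f]
  proof eventually_elim
    case (elim x)
    have "ratio powr (- 1 / 2) = 1 / sqrt ratio"
      using ratio_pos by (simp add: powr_minus_divide powr_half_sqrt)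
    then show ?case
      using elim ratio_pos by (cases "f x = 0") auto
  qed
  have "L2_inner M (S_op N A k f) g
      = (\<integral>x. indicator (Ran N A k) x *\<^sub>R (?p (shift x) * f (shift x) * cnj (g x)) \<partial>M)"
    unfolding L2_inner_def S_op_def
    by (intro Bochner_Integration.integral_cong) (auto simp: indicator_def)
  also have "\<dots> = (\<integral>x. ?p (shift x) * f (shift x) * cnj (g x) \<partial>MR k)"
    by (rule integral_restrict_space[symmetric]) auto
  also have "\<dots> = ratio *\<^sub>R (\<integral>x. ?p x * f x * cnj (g (prepend k x)) \<partial>MD k)"
    using integral_MR(1)[OF assms(1) F] by (simp only: shift_prepend)
  also have "\<dots> = (\<integral>x. ratio *\<^sub>R (?p x * f x * cnj (g (prepend k x))) \<partial>MD k)"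
    by (rule integral_scaleR_right[symmetric])
  also have "\<dots> = (\<integral>x. f x * cnj (complex_of_real (sqrt ratio) * g (prepend k x)) \<partial>MD k)"
  proof (rule integral_cong_AE)
    have "complex_of_real ratio * complex_of_real (1 / sqrt ratio) = complex_of_real (sqrt ratio)"
      using ratio_pos by (simp add: real_div_sqrt flip: of_real_mult of_real_divide)
    then have key: "complex_of_real ratio * (complex_of_real (1 / sqrt ratio) * a * b)
        = a * (complex_of_real (sqrt ratio) * b)" for a b
      by (metis mult.assoc mult.commute)
    show "AE x in MD k. ratio *\<^sub>R (?p x * f x * cnj (g (prepend k x)))
        = f x * cnj (complex_of_real (sqrt ratio) * g (prepend k x))"
      using ae by eventually_elim (simp only: key scaleR_conv_of_real complex_cnj_mult complex_cnj_complex_of_real)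
  qed measurable
  also have "\<dots> = (\<integral>x. indicator (Dom N A k) x *\<^sub>R
      (f x * cnj (complex_of_real (sqrt ratio) * g (prepend k x))) \<partial>M)"
    by (rule integral_restrict_space) auto
  also have "\<dots> = L2_inner M f (pullback k g)"
    unfolding L2_inner_def pullback_def
    by (intro Bochner_Integration.integral_cong) (auto simp: indicator_def)
  finally show ?thesis .
qed

lemma S_adj_AE:
  assumes "k < N" and g: "g \<in> L2 M"
  shows "S_adj N A k g \<in> L2 M" and "AE x in M. S_adj N A k g x = pullback k g x"
  unfolding S_adj_def using pullback_L2[OF assms] S_op_adjoint[OF assms(1) _ g]
  by (auto intro: L2_adjoint_AE)

lemma proj_measure_S_adj:
  assumes "k < N" and g: "g \<in> L2 M"
  shows "proj_measure M (S_adj N A k g) = proj_measure M (pullback k g)"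
proof -
  have "S_adj N A k g \<in> borel_measurable M" "pullback k g \<in> borel_measurable M"
    using S_adj_AE(1)[OF assms] pullback_L2[OF assms] by (auto simp: L2_def)
  then show ?thesis
    unfolding proj_measure_eq_density[OF S_adj_AE(1)[OF assms]] proj_measure_eq_density[OF pullback_L2[OF assms]]
    using S_adj_AE(2)[OF assms] by (intro density_cong) (auto elim!: eventually_mono)
qed

lemma integral_proj_measure_S_adj:
  fixes \<psi> \<phi> :: "(nat \<Rightarrow> nat) \<Rightarrow> complex"
  assumes "k < N" and f: "f \<in> L2 M" and \<psi>: "\<psi> \<in> borel_measurable M"
    and \<phi>: "\<phi> \<in> borel_measurable M" "\<And>x. x \<in> Dom N A k \<Longrightarrow> \<phi> x = \<psi> (prepend k x)"
  shows "(\<integral>x. \<phi> x \<partial>proj_measure M (S_adj N A k f))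
    = (\<integral>x. indicator (Ran N A k) x *\<^sub>R ((cmod (f x))\<^sup>2 *\<^sub>R \<psi> x) \<partial>M)"
proof -
  have fM: "f \<in> borel_measurable M"
    using f by (simp add: L2_def)
  have [measurable]: "f \<in> borel_measurable (MR k)" "\<psi> \<in> borel_measurable (MR k)"
    using fM \<psi> by (auto intro: measurable_MR)
  have "(\<integral>x. \<phi> x \<partial>proj_measure M (S_adj N A k f)) = (\<integral>x. (cmod (pullback k f x))\<^sup>2 *\<^sub>R \<phi> x \<partial>M)"
    unfolding proj_measure_S_adj[OF assms(1) f]
    by (rule integral_proj_measure[OF pullback_L2[OF assms(1) f] \<phi>(1)])
  also have "\<dots> = (\<integral>x. indicator (Dom N A k) x *\<^sub>R
      (ratio *\<^sub>R ((cmod (f (prepend k x)))\<^sup>2 *\<^sub>R \<psi> (prepend k x))) \<partial>M)"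
    using ratio_pos
    by (intro Bochner_Integration.integral_cong)
       (auto simp: pullback_def \<phi>(2) norm_mult power_mult_distrib indicator_def)
  also have "\<dots> = (\<integral>x. ratio *\<^sub>R ((cmod (f (prepend k x)))\<^sup>2 *\<^sub>R \<psi> (prepend k x)) \<partial>MD k)"
    by (rule integral_restrict_space[symmetric]) auto
  also have "\<dots> = (\<integral>x. (cmod (f x))\<^sup>2 *\<^sub>R \<psi> x \<partial>MR k)"
    by (subst integral_MR(1)[OF assms(1)]) (simp_all only: integral_scaleR_right, measurable)
  also have "\<dots> = (\<integral>x. indicator (Ran N A k) x *\<^sub>R ((cmod (f x))\<^sup>2 *\<^sub>R \<psi> x) \<partial>M)"
    by (rule integral_restrict_space) auto
  finally show ?thesis .
qed

text \<open>
  The functions \<open>\<phi> k\<close> are prescribed on \<open>D\<^sub>k\<close> only, since \<open>S\<^sub>k\<^sup>* f\<close>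
  vanishes almost everywhere outside \<open>D\<^sub>k\<close>.  This covers both \<open>\<psi> \<circ> \<sigma>\<^sub>k\<close>
  extended by \<open>0\<close> and the exponentials in the Fourier transforms.
\<close>

lemma sum_integral_proj_measure_S_adj:
  fixes \<psi> :: "(nat \<Rightarrow> nat) \<Rightarrow> complex" and \<phi> :: "nat \<Rightarrow> (nat \<Rightarrow> nat) \<Rightarrow> complex"
  assumes f: "f \<in> L2 M" and \<psi>: "\<psi> \<in> borel_measurable M"
    and bound: "\<And>x. x \<in> Lam N A \<Longrightarrow> cmod (\<psi> x) \<le> C"
    and \<phi>: "\<And>k. k < N \<Longrightarrow> \<phi> k \<in> borel_measurable M"
      "\<And>k x. k < N \<Longrightarrow> x \<in> Dom N A k \<Longrightarrow> \<phi> k x = \<psi> (prepend k x)"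
  shows "(\<Sum>k<N. \<integral>x. \<phi> k x \<partial>proj_measure M (S_adj N A k f)) = (\<integral>x. \<psi> x \<partial>proj_measure M f)"
proof -
  let ?F = "\<lambda>x. (cmod (f x))\<^sup>2 *\<^sub>R \<psi> x"
  have [measurable]: "f \<in> borel_measurable M" and [measurable]: "\<psi> \<in> borel_measurable M"
    using f \<psi> by (auto simp: L2_def)
  have "integrable M (\<lambda>x. C * (cmod (f x))\<^sup>2)"
    using f by (simp add: L2_def)
  \<comment> \<open>The boundedness of \<open>\<psi>\<close> matters here: without integrability the sum and the integral need not commute.\<close>
  then have int: "integrable M ?F"
  proof (rule Bochner_Integration.integrable_bound)
    show "AE x in M. norm (?F x) \<le> norm (C * (cmod (f x))\<^sup>2)"
    proof (rule AE_I2)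
      fix x assume "x \<in> space M"
      then have "cmod (\<psi> x) \<le> \<bar>C\<bar>"
        using bound[of x] by simp
      then show "norm (?F x) \<le> norm (C * (cmod (f x))\<^sup>2)"
        by (simp add: abs_mult mult_right_mono mult.commute)
    qed
  qed measurable
  have "(\<Sum>k<N. \<integral>x. \<phi> k x \<partial>proj_measure M (S_adj N A k f))
      = (\<Sum>k<N. \<integral>x. indicator (Ran N A k) x *\<^sub>R ?F x \<partial>M)"
    using \<phi> by (intro sum.cong refl integral_proj_measure_S_adj f \<psi>) auto
  also have "\<dots> = (\<integral>x. (\<Sum>k<N. indicator (Ran N A k) x *\<^sub>R ?F x) \<partial>M)"
    using int
    by (intro Bochner_Integration.integral_sum[symmetric] integrable_mult_indicator) auto
  also have "\<dots> = (\<integral>x. ?F x \<partial>M)"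
  proof (intro Bochner_Integration.integral_cong refl)
    fix x assume "x \<in> space M"
    then have x: "x \<in> Lam N A" by simp
    then have "x 0 \<in> {..<N}" by (simp add: Lam_def)
    have "(\<Sum>k<N. indicator (Ran N A k) x *\<^sub>R ?F x) = (\<Sum>k<N. if k = x 0 then ?F x else 0)"
      using x by (intro sum.cong) (auto simp: Ran_def indicator_def)
    then show "(\<Sum>k<N. indicator (Ran N A k) x *\<^sub>R ?F x) = ?F x"
      using \<open>x 0 \<in> {..<N}\<close> by simp
  qed
  also have "\<dots> = (\<integral>x. \<psi> x \<partial>proj_measure M f)"
    by (rule integral_proj_measure[OF f \<psi>, symmetric])
  finally show ?thesis .
qed

end

section \<open>The integral identity and the Fourier transform\<close>

lemma emeasure_space_nonzero_if_L2_norm: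
  assumes "L2_norm M f \<noteq> 0"
  shows "emeasure M (space M) \<noteq> 0"
proof
  assume "emeasure M (space M) = 0"
  then have "AE x in M. (cmod (f x))\<^sup>2 = 0"
    by (intro AE_I[of _ _ "space M"]) auto
  then have "(\<integral>x. (cmod (f x))\<^sup>2 \<partial>M) = 0"
    by (rule integral_eq_zero_AE)
  then show False
    using assms by (simp add: L2_norm_def)
qed

theorem proposition2p21:
  fixes N :: nat
    and A :: "nat \<Rightarrow> nat \<Rightarrow> nat"
    and f :: "(nat \<Rightarrow> nat) \<Rightarrow> complex"
  assumes "N \<ge> 2"
    and "\<forall>i<N. \<forall>j<N. A i j \<in> {0, 1}"
    and "\<forall>i<N. A i i = 1"
    and "f \<in> L2 (muA N A)"
    and "L2_norm (muA N A) f = 1"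
  shows "(\<forall>\<psi> :: (nat \<Rightarrow> nat) \<Rightarrow> complex. continuous_on (Lam N A) \<psi> \<longrightarrow>
            (\<Sum>k<N. \<integral>x. (if x \<in> Dom N A k then \<psi> (prepend k x) else 0)
                        \<partial>proj_measure (muA N A) (S_adj N A k f))
            = (\<integral>x. \<psi> x \<partial>proj_measure (muA N A) f))
       \<and> (\<forall>t :: real.
            fourier N (proj_measure (muA N A) f) t
            = (\<Sum>k<N. exp (\<i> * complex_of_real (t * real k / real N)) *
                 fourier N (proj_measure (muA N A) (S_adj N A k f)) (t / real N)))"
proof (intro conjI allI impI)
  have "emeasure (muA N A) (Lam N A) \<noteq> 0"
    using emeasure_space_nonzero_if_L2_norm[of "muA N A" f] assms(5) by simp
  then interpret nontrivial_system N A
    using assms(1) by unfold_locales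
  {
    fix \<psi> :: "(nat \<Rightarrow> nat) \<Rightarrow> complex"
    assume cont: "continuous_on (Lam N A) \<psi>"
    have \<psi>: "\<psi> \<in> borel_measurable (muA N A)"
      using borel_measurable_continuous_on_restrict[OF cont]
      by (simp add: measurable_cong_sets[OF sets_muA refl])
    have "bounded (\<psi> ` Lam N A)"
      by (intro compact_imp_bounded compact_continuous_image cont compact_Lam)
    then obtain C where C: "\<And>x. x \<in> Lam N A \<Longrightarrow> cmod (\<psi> x) \<le> C"
      by (auto simp: bounded_iff)
    have meas: "(\<lambda>x. if x \<in> Dom N A k then \<psi> (prepend k x) else 0) \<in> borel_measurable (muA N A)"
      if "k < N" for k
      using measurable_compose[OF measurable_prepend_MD[OF that] measurable_MR[OF \<psi>]]
      by (subst (asm) measurable_restrict_space_iff[where c = 0]) auto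
    show "(\<Sum>k<N. \<integral>x. (if x \<in> Dom N A k then \<psi> (prepend k x) else 0)
            \<partial>proj_measure (muA N A) (S_adj N A k f)) = (\<integral>x. \<psi> x \<partial>proj_measure (muA N A) f)"
      by (rule sum_integral_proj_measure_S_adj[OF assms(4) \<psi> C]) (use meas in auto)
  }
  fix t :: real
  define e :: "real \<Rightarrow> (nat \<Rightarrow> nat) \<Rightarrow> complex"
    where "e s x = exp (\<i> * complex_of_real (s * val N x))" for s x
  have e: "e s \<in> borel_measurable (muA N A)" for s
  proof (rule measurable_muA)
    have "continuous_on UNIV (\<lambda>v. exp (\<i> * complex_of_real (s * v)))"
      by (intro continuous_intros)
    then show "e s \<in> borel_measurable borel"
      unfolding e_def[abs_def]
      by (intro measurable_compose[OF measurable_val] borel_measurable_continuous_onI)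
  qed
  have e_prepend: "exp (\<i> * complex_of_real (t * real k / real N)) * e (t / real N) x = e t (prepend k x)"
    if "x \<in> Dom N A k" for k x
  proof -
    have "x \<in> Lam N A"
      using that Dom_subset by auto
    then show ?thesis
      using val_prepend[OF assms(1), of x A k]
      by (simp add: e_def exp_add[symmetric] add_divide_distrib distrib_left add.commute)
  qed
  have "(\<Sum>k<N. \<integral>x. exp (\<i> * complex_of_real (t * real k / real N)) * e (t / real N) x
        \<partial>proj_measure (muA N A) (S_adj N A k f)) = (\<integral>x. e t x \<partial>proj_measure (muA N A) f)"
  proof (rule sum_integral_proj_measure_S_adj[OF assms(4) e, where C = 1])
    show "cmod (e t x) \<le> 1" for x
      by (simp only: e_def norm_exp_i_times order_refl)
    show "(\<lambda>x. exp (\<i> * complex_of_real (t * real k / real N)) * e (t / real N) x)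
        \<in> borel_measurable (muA N A)" for k
      by (intro borel_measurable_times borel_measurable_const e)
  qed (rule e_prepend)
  then show "fourier N (proj_measure (muA N A) f) t
      = (\<Sum>k<N. exp (\<i> * complex_of_real (t * real k / real N)) *
           fourier N (proj_measure (muA N A) (S_adj N A k f)) (t / real N))"
    by (simp add: fourier_def e_def)
qed

end
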